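(* A retract of a Rudin space is a Rudin space: if $X$ is a Rudin space, $Y$ is a $T_0$ space, and there are continuous maps $f:X\to Y$ and $g:Y\to X$ with $f\circ g=\mathrm{id}_Y$, then $Y$ is a Rudin space.
   Context: For a $T_0$ space $X$, the specialization order is $x\le y$ iff $x\in\overline{\{y\}}$. $\mathsf{K}(X)$ is the set of nonempty compact saturated subsets (saturated = upper set in the specialization order). A family $\mathcal K\subseteq \mathsf K(X)$ is filtered if it is nonempty and for all $K_1,K_2\in\mathcal K$ there is $K_3\in\mathcal K$ with $K_3\subseteq K_1\cap K_2$. A nonempty subset $A$ is irreducible if whenever $A\subseteq F_1\cup F_2$ with $F_1,F_2$ closed, then $A\subseteq F_1$ or $A\subseteq F_2$. A Rudin set is a nonempty closed subset $A$ of $X$ for which there is a filtered family $\mathcal K\subseteq\mathsf K(X)$ such that $A$ is minimal (under inclusion) among the closed subsets of $X$ that meet every member of $\mathcal K$. A $T_0$ space $X$ is a Rudin space if every irreducible closed subset of $X$ is a Rudin set. *)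

theory Defs
  imports "HOL-Analysis.Abstract_Topological_Spaces"
begin

(* No carrier guards are needed: X closure_of {y} is a subset of topspace X,
   and it is empty if y is not in topspace X. *)
definition specialization_le :: "'a topology \<Rightarrow> 'a \<Rightarrow> 'a \<Rightarrow> bool" where
  "specialization_le X x y \<longleftrightarrow> x \<in> X closure_of {y}"

definition saturatedin :: "'a topology \<Rightarrow> 'a set \<Rightarrow> bool" where
  "saturatedin X S \<longleftrightarrow>
     S \<subseteq> topspace X \<and> (\<forall>x\<in>S. \<forall>y\<in>topspace X. specialization_le X x y \<longrightarrow> y \<in> S)"

definition compact_saturated_sets :: "'a topology \<Rightarrow> 'a set set" where
  "compact_saturated_sets X = {K. K \<noteq> {} \<and> compactin X K \<and> saturatedin X K}"

definition filtered_family :: "'a set set \<Rightarrow> bool" where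
  "filtered_family \<K> \<longleftrightarrow>
     \<K> \<noteq> {} \<and> (\<forall>K1\<in>\<K>. \<forall>K2\<in>\<K>. \<exists>K3\<in>\<K>. K3 \<subseteq> K1 \<inter> K2)"

definition irreduciblein :: "'a topology \<Rightarrow> 'a set \<Rightarrow> bool" where
  "irreduciblein X A \<longleftrightarrow>
     A \<subseteq> topspace X \<and> A \<noteq> {} \<and>
     (\<forall>F1 F2. closedin X F1 \<and> closedin X F2 \<and> A \<subseteq> F1 \<union> F2 \<longrightarrow> A \<subseteq> F1 \<or> A \<subseteq> F2)"

definition closed_meeting :: "'a topology \<Rightarrow> 'a set set \<Rightarrow> 'a set \<Rightarrow> bool" where
  "closed_meeting X \<K> A \<longleftrightarrow> closedin X A \<and> (\<forall>K\<in>\<K>. A \<inter> K \<noteq> {})"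

definition rudin_set :: "'a topology \<Rightarrow> 'a set \<Rightarrow> bool" where
  "rudin_set X A \<longleftrightarrow>
     A \<noteq> {} \<and> closedin X A \<and>
     (\<exists>\<K> \<subseteq> compact_saturated_sets X. filtered_family \<K> \<and>
        closed_meeting X \<K> A \<and> (\<forall>B. closed_meeting X \<K> B \<and> B \<subseteq> A \<longrightarrow> B = A))"

definition rudin_space :: "'a topology \<Rightarrow> bool" where
  "rudin_space X \<longleftrightarrow>
     t0_space X \<and> (\<forall>A. closedin X A \<and> irreduciblein X A \<longrightarrow> rudin_set X A)"

end

theory Submission
  imports Defs
begin

text \<open>
  The closure of a continuous image of a Rudin set is a Rudin set: if \<open>A\<close> is minimal for \<open>\<K>\<close>, then
  \<open>closure (f A)\<close> is minimal for the saturations of the sets \<open>f (K \<inter> A)\<close>, \<open>K \<in> \<K>\<close>. Intersecting with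
  \<open>A\<close> before taking images is essential: it makes the preimage of a closed set that meets all
  these saturations meet every \<open>K \<in> \<K>\<close> inside \<open>A\<close>. For a retract, an irreducible closed \<open>A\<close> in \<open>Y\<close>
  is \<open>closure (f (closure (g A)))\<close>, and \<open>closure (g A)\<close> is irreducible.
\<close>

text \<open>For \<open>S\<close> inside \<open>topspace X\<close> this is the intersection of all
  open sets containing \<open>S\<close>, hence the least saturated set containing
  \<open>S\<close>.\<close>

definition saturation_of :: "'a topology \<Rightarrow> 'a set \<Rightarrow> 'a set" where
  "saturation_of X S = {y \<in> topspace X. \<exists>x\<in>S. specialization_le X x y}"

lemma specialization_le_refl: "x \<in> topspace X \<Longrightarrow> specialization_le X x x"
  by (simp add: specialization_le_def in_closure_of)

lemma specialization_le_trans: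
  "specialization_le X x y \<Longrightarrow> specialization_le X y z \<Longrightarrow> specialization_le X x z"
  by (auto simp: specialization_le_def in_closure_of)

lemma specialization_le_openin:
  "specialization_le X x y \<Longrightarrow> openin X U \<Longrightarrow> x \<in> U \<Longrightarrow> y \<in> U"
  by (auto simp: specialization_le_def in_closure_of)

text \<open>The closure of a point \<open>y\<close> of \<open>C\<close> stays inside
  \<open>C\<close>; so closed sets are lower sets, dually to open sets being upper sets.\<close>

lemma specialization_le_closedin:
  "specialization_le X x y \<Longrightarrow> closedin X C \<Longrightarrow> y \<in> C \<Longrightarrow> x \<in> C"
  unfolding specialization_le_def
  by (metis closure_of_minimal empty_subsetI insert_subset subsetD)

lemma saturation_of_superset: "S \<subseteq> topspace X \<Longrightarrow> S \<subseteq> saturation_of X S"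
  by (auto simp: saturation_of_def intro: specialization_le_refl)

lemma saturation_of_mono: "S \<subseteq> T \<Longrightarrow> saturation_of X S \<subseteq> saturation_of X T"
  by (auto simp: saturation_of_def)

lemma saturatedin_saturation_of: "saturatedin X (saturation_of X S)"
  by (auto simp: saturatedin_def saturation_of_def intro: specialization_le_trans)

text \<open>Since \<open>C\<close> is a lower set, a point of \<open>C\<close> above some
  \<open>x\<close> in \<open>S\<close> forces \<open>x\<close> itself into \<open>C\<close>. This
  lets saturations be dropped when testing whether a closed set meets them.\<close>

lemma closedin_Int_saturation_of:
  assumes "closedin X C" and "C \<inter> saturation_of X S \<noteq> {}"
  shows "C \<inter> S \<noteq> {}"
  using assms by (auto simp: saturation_of_def dest: specialization_le_closedin)

text \<open>Open sets are upper sets, so a finite subfamily that covers \<open>S\<close> covers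
  everything above \<open>S\<close> as well.\<close>

lemma compactin_saturation_of:
  assumes "compactin X S"
  shows "compactin X (saturation_of X S)"
  unfolding compactin_def
proof (intro conjI allI impI)
  show "saturation_of X S \<subseteq> topspace X"
    by (auto simp: saturation_of_def)
next
  fix \<U>
  assume \<U>: "Ball \<U> (openin X) \<and> saturation_of X S \<subseteq> \<Union>\<U>"
  have "S \<subseteq> \<Union>\<U>"
    using \<U> saturation_of_superset[OF compactin_subset_topspace[OF assms]] by blast
  then obtain \<F> where \<F>: "finite \<F>" "\<F> \<subseteq> \<U>" "S \<subseteq> \<Union>\<F>"
    using assms \<U> unfolding compactin_def by meson
  have "saturation_of X S \<subseteq> \<Union>\<F>"
  proof
    fix y assume "y \<in> saturation_of X S"
    then obtain x where "x \<in> S" and le: "specialization_le X x y"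
      by (auto simp: saturation_of_def)
    then obtain U where "U \<in> \<F>" "x \<in> U"
      using \<F> by blast
    then show "y \<in> \<Union>\<F>"
      using specialization_le_openin[OF le] \<F>(2) \<U> by blast
  qed
  then show "\<exists>\<F>. finite \<F> \<and> \<F> \<subseteq> \<U> \<and> saturation_of X S \<subseteq> \<Union>\<F>"
    using \<F> by blast
qed

lemma saturation_of_in_compact_saturated_sets:
  assumes "compactin X S" and "S \<noteq> {}"
  shows "saturation_of X S \<in> compact_saturated_sets X"
  using assms saturation_of_superset[OF compactin_subset_topspace[OF assms(1)]]
  by (auto simp: compact_saturated_sets_def compactin_saturation_of saturatedin_saturation_of)

lemma filtered_family_image:
  assumes "filtered_family \<K>" and "\<And>K L. K \<subseteq> L \<Longrightarrow> h K \<subseteq> h L"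
  shows "filtered_family (h ` \<K>)"
  unfolding filtered_family_def
proof (intro conjI ballI)
  show "h ` \<K> \<noteq> {}"
    using assms(1) by (simp add: filtered_family_def)
next
  fix L1 L2 assume "L1 \<in> h ` \<K>" "L2 \<in> h ` \<K>"
  then obtain K1 K2 where K: "K1 \<in> \<K>" "K2 \<in> \<K>" "L1 = h K1" "L2 = h K2"
    by blast
  then obtain K3 where "K3 \<in> \<K>" "K3 \<subseteq> K1 \<inter> K2"
    using assms(1) unfolding filtered_family_def by blast
  then show "\<exists>L3\<in>h ` \<K>. L3 \<subseteq> L1 \<inter> L2"
    using K assms(2)[of K3 K1] assms(2)[of K3 K2] by blast
qed

lemma rudin_set_closure_of_image:
  fixes X :: "'a topology"
  assumes f: "continuous_map X Y f" and "rudin_set X A"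
  shows "rudin_set Y (Y closure_of f ` A)"
proof -
  have ne: "A \<noteq> {}" and clA: "closedin X A"
    using assms(2) by (simp_all add: rudin_set_def)
  obtain \<K> where \<K>: "\<K> \<subseteq> compact_saturated_sets X" "filtered_family \<K>"
    and "closed_meeting X \<K> A" and min: "\<forall>B. closed_meeting X \<K> B \<and> B \<subseteq> A \<longrightarrow> B = A"
    using assms(2) unfolding rudin_set_def by (elim conjE exE)
  then have meet: "\<And>K. K \<in> \<K> \<Longrightarrow> A \<inter> K \<noteq> {}"
    by (simp add: closed_meeting_def)
  define h where "h K = saturation_of Y (f ` (A \<inter> K))" for K
  have sub: "f ` A \<subseteq> topspace Y"
    using f closedin_subset[OF clA] by (auto simp: continuous_map_def)
  have fA: "f ` A \<subseteq> Y closure_of f ` A"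
    by (rule closure_of_subset[OF sub])
  have "h ` \<K> \<subseteq> compact_saturated_sets Y"
  proof
    fix L assume "L \<in> h ` \<K>"
    then obtain K where K: "K \<in> \<K>" "L = h K" by blast
    then have "compactin X K"
      using \<K>(1) by (auto simp: compact_saturated_sets_def)
    \<comment> \<open>Closedness of \<open>A\<close> makes \<open>A \<inter> K\<close> compact, and
      continuity carries this over to its image.\<close>
    then have "compactin Y (f ` (A \<inter> K))"
      by (intro image_compactin[OF _ f] closed_Int_compactin[OF clA])
    then show "L \<in> compact_saturated_sets Y"
      unfolding K(2) h_def
      by (rule saturation_of_in_compact_saturated_sets) (use meet[OF K(1)] in blast)
  qed
  moreover have "filtered_family (h ` \<K>)"
  proof (rule filtered_family_image[OF \<K>(2)])
    fix K L :: "'a set"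
    assume "K \<subseteq> L"
    then show "h K \<subseteq> h L"
      unfolding h_def by (intro saturation_of_mono image_mono Int_mono order_refl)
  qed
  moreover have "closed_meeting Y (h ` \<K>) (Y closure_of f ` A)"
    unfolding closed_meeting_def
  proof (intro conjI ballI)
    fix L assume "L \<in> h ` \<K>"
    then obtain K where K: "K \<in> \<K>" "L = h K" by blast
    \<comment> \<open>The image of a point of \<open>A \<inter> K\<close> is a common point of
      \<open>L\<close> and the closure.\<close>
    have "f ` (A \<inter> K) \<subseteq> L"
      unfolding K(2) h_def by (rule saturation_of_superset) (use sub in blast)
    then show "Y closure_of f ` A \<inter> L \<noteq> {}"
      using meet[OF K(1)] fA by blast
  qed simp
  moreover have "C = Y closure_of f ` A"
    if C: "closed_meeting Y (h ` \<K>) C" "C \<subseteq> Y closure_of f ` A" for C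
  proof -
    have clC: "closedin Y C"
      using C(1) by (simp add: closed_meeting_def)
    \<comment> \<open>The part of \<open>A\<close> that \<open>f\<close> maps into \<open>C\<close>.
      Once it is known to meet every member of \<open>\<K>\<close>, minimality of \<open>A\<close>
      gives \<open>B = A\<close>, so that \<open>C\<close> contains the image of \<open>A\<close>
      and hence its closure.\<close>
    define B where "B = A \<inter> {x \<in> topspace X. f x \<in> C}"
    have "closedin X B"
      unfolding B_def
      by (rule closedin_Int[OF clA closedin_continuous_map_preimage[OF f clC]])
    moreover have "B \<inter> K \<noteq> {}" if "K \<in> \<K>" for K
    proof -
      have "C \<inter> h K \<noteq> {}"
        using C(1) that by (simp add: closed_meeting_def)
      \<comment> \<open>A point of this intersection is \<open>f x\<close> with \<open>x\<close> in
        \<open>A \<inter> K\<close>; this \<open>x\<close> lies in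
        \<open>B \<inter> K\<close>.\<close>
      then have "C \<inter> f ` (A \<inter> K) \<noteq> {}"
        unfolding h_def by (rule closedin_Int_saturation_of[OF clC])
      then show ?thesis
        using closedin_subset[OF clA] by (auto simp: B_def)
    qed
    ultimately have "closed_meeting X \<K> B"
      by (simp add: closed_meeting_def)
    moreover have "B \<subseteq> A"
      by (simp add: B_def)
    ultimately have "B = A"
      using min by simp
    then have "f ` A \<subseteq> C"
      unfolding B_def by blast
    then show ?thesis
      by (intro subset_antisym[OF C(2)] closure_of_minimal clC)
  qed
  moreover have "Y closure_of f ` A \<noteq> {}"
    using fA ne by blast
  ultimately show ?thesis
    unfolding rudin_set_def
    by (intro conjI exI[of _ "h ` \<K>"] closedin_closure_of allI impI; (elim conjE)?) simp_all
qed

text \<open>Two closed sets covering the closure have closed preimages under \<open>g\<close>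
  covering \<open>A\<close>. Irreducibility puts \<open>A\<close> into one of them, and the
  corresponding closed set then contains the whole closure.\<close>

lemma irreduciblein_closure_of_image:
  assumes g: "continuous_map Y X g" and "irreduciblein Y A"
  shows "irreduciblein X (X closure_of g ` A)"
proof -
  have A: "A \<subseteq> topspace Y" "A \<noteq> {}"
    using assms(2) by (simp_all add: irreduciblein_def)
  have irr: "\<forall>F1 F2. closedin Y F1 \<and> closedin Y F2 \<and> A \<subseteq> F1 \<union> F2 \<longrightarrow> A \<subseteq> F1 \<or> A \<subseteq> F2"
    using assms(2) unfolding irreduciblein_def by (elim conjE)
  have "g ` A \<subseteq> topspace X"
    using g A by (auto simp: continuous_map_def)
  then have gA: "g ` A \<subseteq> X closure_of g ` A"
    by (rule closure_of_subset)
  have "X closure_of g ` A \<subseteq> F1 \<or> X closure_of g ` A \<subseteq> F2"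
    if F: "closedin X F1" "closedin X F2" "X closure_of g ` A \<subseteq> F1 \<union> F2" for F1 F2
  proof -
    have "A \<subseteq> {y \<in> topspace Y. g y \<in> F1} \<union> {y \<in> topspace Y. g y \<in> F2}"
      using A gA F(3) by blast
    then have "A \<subseteq> {y \<in> topspace Y. g y \<in> F1} \<or> A \<subseteq> {y \<in> topspace Y. g y \<in> F2}"
      by (intro irr[rule_format] conjI closedin_continuous_map_preimage[OF g] F)
    then have "g ` A \<subseteq> F1 \<or> g ` A \<subseteq> F2"
      by blast
    then show ?thesis
      using closure_of_minimal[OF _ F(1)] closure_of_minimal[OF _ F(2)] by (elim disjE) simp_all
  qed
  moreover have "X closure_of g ` A \<noteq> {}"
    using gA A(2) by blast
  ultimately show ?thesis
    by (simp add: irreduciblein_def closure_of_subset_topspace)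
qed

theorem corollary4p11:
  fixes X :: "'a topology" and Y :: "'b topology"
    and f :: "'a \<Rightarrow> 'b" and g :: "'b \<Rightarrow> 'a"
  assumes "rudin_space X"
    and "t0_space Y"
    and "continuous_map X Y f"
    and "continuous_map Y X g"
    and "\<forall>y\<in>topspace Y. f (g y) = y"
  shows "rudin_space Y"
  unfolding rudin_space_def
proof (intro conjI allI impI)
  show "t0_space Y" by fact
next
  fix A assume A: "closedin Y A \<and> irreduciblein Y A"
  let ?B = "X closure_of g ` A"
  have AY: "A \<subseteq> topspace Y"
    using A closedin_subset by blast
  then have fgA: "f ` g ` A = A"
    using assms(5) by (force simp: image_image)
  have "g ` A \<subseteq> topspace X"
    using assms(4) AY by (auto simp: continuous_map_def)
  then have "g ` A \<subseteq> ?B"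
    by (rule closure_of_subset)
  then have "A \<subseteq> f ` ?B"
    using fgA by blast
  \<comment> \<open>Continuity sends the closure of the image of \<open>A\<close> under
    \<open>g\<close> into the closure of \<open>A\<close>, by \<open>fgA\<close>, and
    \<open>A\<close> is closed. So \<open>f\<close> maps \<open>?B\<close> exactly onto
    \<open>A\<close>.\<close>
  moreover have "f ` ?B \<subseteq> A"
    using continuous_map_image_closure_subset[OF assms(3), of "g ` A"] A
    by (simp add: fgA closure_of_closedin)
  ultimately have "Y closure_of f ` ?B = A"
    using A closure_of_closedin by (metis subset_antisym)
  moreover have "rudin_set X ?B"
    using assms(1) A irreduciblein_closure_of_image[OF assms(4)]
    by (simp add: rudin_space_def)
  ultimately show "rudin_set Y A"
    using rudin_set_closure_of_image[OF assms(3)] by metis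
qed

end
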